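(* For any graphs $G$ and $H$, \[ \sigma(G \ast H) \geq \vartheta(G)\,\vartheta(H), \quad\text{i.e.}\quad \chi(\overline{G} \boxtimes \overline{H}) \geq \vartheta(G)\,\vartheta(H), \] \[ \sigma(G \ast H) \geq \vartheta^+(G)\,\vartheta^-(H), \quad\text{i.e.}\quad \chi(\overline{G} \boxtimes \overline{H}) \geq \vartheta^+(G)\,\vartheta^-(H). \] As a consequence, for every graph $G$, \[ \inf_H \frac{\sigma(G \ast H)}{\vartheta(H)} \geq \vartheta(G), \qquad \inf_H \frac{\sigma(G \ast H)}{\vartheta^-(H)} \geq \vartheta^+(G), \qquad \inf_H \frac{\sigma(G \ast H)}{\vartheta^+(H)} \geq \vartheta^-(G), \] where the infima range over all graphs $H$; equivalently, in each of these three inequalities $\sigma(G\ast H)$ may be replaced by $\chi(\overline{G}\boxtimes\overline{H})$.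
   Context: All graphs $G=(V,E)$ are finite, undirected, without loops, with nonempty vertex set; $\overline{G}$ is the complementary graph. For $G=(V,E)$ and $H=(V',E')$, both the strong product $G\boxtimes H$ and the disjunctive product $G\ast H$ have vertex set $V\times V'$. In $G\boxtimes H$, $(v,v')$ and $(w,w')$ are adjacent iff ($v=w$ and $v'w'\in E'$) or ($vw\in E$ and $v'=w'$) or ($vw\in E$ and $v'w'\in E'$). In $G\ast H$, $(v,v')$ and $(w,w')$ are adjacent iff $vw\in E$ or $v'w'\in E'$. One has $\overline{G\boxtimes H}=\overline{G}\ast\overline{H}$. $\chi$ is the chromatic number, and $\sigma(G)=\chi(\overline{G})$ is the clique covering number (minimum number of cliques covering the vertex set of $G$). The Lovász number and its Schrijver and Szegedy variants are \[ \vartheta(G)=\max \operatorname{Tr} BJ \ \text{ s.t. } B\geq 0,\ \operatorname{Tr} B=1,\ B_{vw}=0\ \forall vw\in E, \] \[ \vartheta^-(G) = \max \operatorname{Tr} BJ \ \text{ s.t. } B\geq 0,\ \operatorname{Tr} B=1,\ B_{vw}\geq 0\ \forall v,w\in V,\ B_{vw}=0\ \forall vw\in E, \] \[ \vartheta^+(G) = \max \operatorname{Tr} BJ \ \text{ s.t. } B\geq 0,\ \operatorname{Tr} B=1,\ B_{vw}\leq 0\ \forall vw\in E, \] where $B$ ranges over real symmetric matrices indexed by $V$, $B\ge 0$ means positive semidefinite, and $J$ is the all-ones matrix. *)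

theory Defs
  imports "HOL-Analysis.Analysis" "Graph_Theory.Pair_Digraph"
begin

text \<open>
  An undirected graph is a digraph whose arc set is symmetric: the edge \<open>vw\<close> is the pair of arcs
  \<open>(v, w)\<close> and \<open>(w, v)\<close>.
\<close>

definition simple_graph :: "'a pair_pre_digraph \<Rightarrow> bool" where
  "simple_graph G \<longleftrightarrow> pair_graph G \<and> pverts G \<noteq> {}"

definition complement_graph :: "'a pair_pre_digraph \<Rightarrow> 'a pair_pre_digraph" where
  "complement_graph G = \<lparr> pverts = pverts G,
     parcs = {(v, w). v \<in> pverts G \<and> w \<in> pverts G \<and> v \<noteq> w \<and> (v, w) \<notin> parcs G} \<rparr>"

definition strong_product ::
    "'a pair_pre_digraph \<Rightarrow> 'b pair_pre_digraph \<Rightarrow> ('a \<times> 'b) pair_pre_digraph" where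
  "strong_product G H = \<lparr> pverts = pverts G \<times> pverts H,
     parcs = {((v, v'), (w, w')). (v, v') \<in> pverts G \<times> pverts H \<and> (w, w') \<in> pverts G \<times> pverts H \<and>
       (v = w \<and> (v', w') \<in> parcs H \<or> (v, w) \<in> parcs G \<and> v' = w' \<or>
        (v, w) \<in> parcs G \<and> (v', w') \<in> parcs H)} \<rparr>"

definition disjunctive_product ::
    "'a pair_pre_digraph \<Rightarrow> 'b pair_pre_digraph \<Rightarrow> ('a \<times> 'b) pair_pre_digraph" where
  "disjunctive_product G H = \<lparr> pverts = pverts G \<times> pverts H,
     parcs = {((v, v'), (w, w')). (v, v') \<in> pverts G \<times> pverts H \<and> (w, w') \<in> pverts G \<times> pverts H \<and>
       ((v, w) \<in> parcs G \<or> (v', w') \<in> parcs H)} \<rparr>"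

definition proper_coloring :: "'a pair_pre_digraph \<Rightarrow> nat \<Rightarrow> ('a \<Rightarrow> nat) \<Rightarrow> bool" where
  "proper_coloring G k c \<longleftrightarrow>
     (\<forall>v\<in>pverts G. c v < k) \<and> (\<forall>v w. (v, w) \<in> parcs G \<longrightarrow> c v \<noteq> c w)"

definition chromatic_number :: "'a pair_pre_digraph \<Rightarrow> nat" where
  "chromatic_number G = (LEAST k. \<exists>c. proper_coloring G k c)"

definition clique_covering_number :: "'a pair_pre_digraph \<Rightarrow> nat" where
  "clique_covering_number G = chromatic_number (complement_graph G)"

lemma simple_graph_iff:
  "simple_graph G \<longleftrightarrow> finite (pverts G) \<and> pverts G \<noteq> {} \<and> parcs G \<subseteq> pverts G \<times> pverts G \<and>
     sym (parcs G) \<and> irrefl (parcs G)"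
proof
  assume "simple_graph G"
  then interpret pair_graph G by (simp add: simple_graph_def)
  have "sym (parcs G)" using pair_sym_arcs by (simp add: symmetric_def)
  then show "finite (pverts G) \<and> pverts G \<noteq> {} \<and> parcs G \<subseteq> pverts G \<times> pverts G \<and>
     sym (parcs G) \<and> irrefl (parcs G)"
    using \<open>simple_graph G\<close> pair_finite_verts arc_fst_in_verts arc_snd_in_verts pair_no_loops
    by (fastforce simp: simple_graph_def irrefl_def)
next
  assume *: "finite (pverts G) \<and> pverts G \<noteq> {} \<and> parcs G \<subseteq> pverts G \<times> pverts G \<and>
     sym (parcs G) \<and> irrefl (parcs G)"
  then have "finite (parcs G)" by (meson finite_SigmaI finite_subset)
  with * have "pair_graph G"
    by unfold_locales (auto simp: symmetric_def irrefl_def arcs_ends_def arc_to_ends_def)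
  with * show "simple_graph G" by (simp add: simple_graph_def)
qed

lemma simple_graph_complement: "simple_graph G \<Longrightarrow> simple_graph (complement_graph G)"
  by (auto simp: simple_graph_iff complement_graph_def sym_def irrefl_def)

lemma simple_graph_strong_product:
  "simple_graph G \<Longrightarrow> simple_graph H \<Longrightarrow> simple_graph (strong_product G H)"
  by (auto simp: simple_graph_iff strong_product_def sym_def irrefl_def)

lemma simple_graph_disjunctive_product:
  "simple_graph G \<Longrightarrow> simple_graph H \<Longrightarrow> simple_graph (disjunctive_product G H)"
  by (auto simp: simple_graph_iff disjunctive_product_def sym_def irrefl_def)


text \<open>Matrices indexed by \<open>V\<close> are functions whose values outside \<open>V \<times> V\<close> are irrelevant.\<close>

definition trace_on :: "'a set \<Rightarrow> ('a \<Rightarrow> 'a \<Rightarrow> real) \<Rightarrow> real" where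
  "trace_on V A = (\<Sum>v\<in>V. A v v)"

definition mat_mult_on ::
    "'a set \<Rightarrow> ('a \<Rightarrow> 'a \<Rightarrow> real) \<Rightarrow> ('a \<Rightarrow> 'a \<Rightarrow> real) \<Rightarrow> 'a \<Rightarrow> 'a \<Rightarrow> real" where
  "mat_mult_on V A B = (\<lambda>u w. \<Sum>v\<in>V. A u v * B v w)"

definition all_ones :: "'a \<Rightarrow> 'a \<Rightarrow> real" where
  "all_ones = (\<lambda>_ _. 1)"

definition psd_on :: "'a set \<Rightarrow> ('a \<Rightarrow> 'a \<Rightarrow> real) \<Rightarrow> bool" where
  "psd_on V B \<longleftrightarrow> (\<forall>v\<in>V. \<forall>w\<in>V. B v w = B w v) \<and>
     (\<forall>x :: 'a \<Rightarrow> real. (\<Sum>v\<in>V. \<Sum>w\<in>V. x v * B v w * x w) \<ge> 0)"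

definition lovasz_feasible :: "'a pair_pre_digraph \<Rightarrow> ('a \<Rightarrow> 'a \<Rightarrow> real) set" where
  "lovasz_feasible G = {B. psd_on (pverts G) B \<and> trace_on (pverts G) B = 1 \<and>
     (\<forall>v w. (v, w) \<in> parcs G \<longrightarrow> B v w = 0)}"

definition schrijver_feasible :: "'a pair_pre_digraph \<Rightarrow> ('a \<Rightarrow> 'a \<Rightarrow> real) set" where
  "schrijver_feasible G = {B. psd_on (pverts G) B \<and> trace_on (pverts G) B = 1 \<and>
     (\<forall>v\<in>pverts G. \<forall>w\<in>pverts G. B v w \<ge> 0) \<and>
     (\<forall>v w. (v, w) \<in> parcs G \<longrightarrow> B v w = 0)}"

definition szegedy_feasible :: "'a pair_pre_digraph \<Rightarrow> ('a \<Rightarrow> 'a \<Rightarrow> real) set" where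
  "szegedy_feasible G = {B. psd_on (pverts G) B \<and> trace_on (pverts G) B = 1 \<and>
     (\<forall>v w. (v, w) \<in> parcs G \<longrightarrow> B v w \<le> 0)}"

text \<open>
  The suprema below are maxima; see \<open>lovasz_theta_max\<close>, \<open>schrijver_theta_max\<close> and
  \<open>szegedy_theta_max\<close>.
\<close>

definition lovasz_theta :: "'a pair_pre_digraph \<Rightarrow> real" where
  "lovasz_theta G = (SUP B\<in>lovasz_feasible G. trace_on (pverts G) (mat_mult_on (pverts G) B all_ones))"

definition schrijver_theta :: "'a pair_pre_digraph \<Rightarrow> real" where
  "schrijver_theta G =
     (SUP B\<in>schrijver_feasible G. trace_on (pverts G) (mat_mult_on (pverts G) B all_ones))"

definition szegedy_theta :: "'a pair_pre_digraph \<Rightarrow> real" where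
  "szegedy_theta G = (SUP B\<in>szegedy_feasible G. trace_on (pverts G) (mat_mult_on (pverts G) B all_ones))"

lemma psd_on_entry_bound:
  assumes V: "finite V" and B: "psd_on V B" and tr: "trace_on V B = 1"
    and u: "u \<in> V" and v: "v \<in> V"
  shows "\<bar>B u v\<bar> \<le> 1"
proof -
  have quad: "(\<Sum>i\<in>V. \<Sum>j\<in>V. x i * B i j * x j) \<ge> 0" for x
    using B by (simp add: psd_on_def)
  have single: "(\<Sum>i\<in>V. (if i = a then f i else 0)) = f a" if "a \<in> V" for a and f :: "'a \<Rightarrow> real"
    using that V by simp
  have diag: "B a a \<ge> 0" if "a \<in> V" for a
  proof -
    have "(\<Sum>i\<in>V. \<Sum>j\<in>V. (if i = a then 1 else 0) * B i j * (if j = a then 1 else 0))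
      = (\<Sum>i\<in>V. if i = a then \<Sum>j\<in>V. (if j = a then B i j else 0) else 0)"
      by (intro sum.cong refl) (auto intro!: sum.cong)
    also have "\<dots> = B a a" using that V by simp
    finally show ?thesis using quad[of "\<lambda>i. if i = a then 1 else 0"] by simp
  qed
  show ?thesis
  proof (cases "u = v")
    case True
    have "B u u \<le> (\<Sum>i\<in>V. B i i)"
      using V u diag by (intro member_le_sum) auto
    with diag[OF u] tr True show ?thesis by (simp add: trace_on_def)
  next
    case False
    have two: "B u u + B v v \<le> 1"
    proof -
      have "(\<Sum>i\<in>{u, v}. B i i) \<le> (\<Sum>i\<in>V. B i i)"
        using V u v diag by (intro sum_mono2) auto
      with tr False show ?thesis by (simp add: trace_on_def)
    qed
    have pm: "B u u + B v v + 2 * s * B u v \<ge> 0" if s: "s * s = 1" for s :: real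
    proof -
      let ?x = "\<lambda>i. (if i = u then 1 else 0) + (if i = v then s else 0)"
      have row: "(\<Sum>j\<in>V. ?x i * B i j * ?x j) = ?x i * (B i u + s * B i v)" for i
      proof -
        have "(\<Sum>j\<in>V. ?x i * B i j * ?x j)
          = (\<Sum>j\<in>V. (if j = u then ?x i * B i j else 0) + (if j = v then ?x i * B i j * s else 0))"
          by (intro sum.cong refl) (simp add: algebra_simps)
        also have "\<dots> = ?x i * (B i u + s * B i v)"
          using single[OF u, of "\<lambda>j. ?x i * B i j"] single[OF v, of "\<lambda>j. ?x i * B i j * s"]
          by (simp add: sum.distrib algebra_simps)
        finally show ?thesis .
      qed
      have "(\<Sum>i\<in>V. \<Sum>j\<in>V. ?x i * B i j * ?x j)
        = (\<Sum>i\<in>V. (if i = u then B i u + s * B i v else 0) + (if i = v then s * (B i u + s * B i v) else 0))"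
        unfolding row by (intro sum.cong refl) (simp add: algebra_simps)
      also have "\<dots> = B u u + s * B u v + s * (B v u + s * B v v)"
        using single[OF u, of "\<lambda>i. B i u + s * B i v"] single[OF v, of "\<lambda>i. s * (B i u + s * B i v)"]
        by (simp add: sum.distrib)
      also have "\<dots> = B u u + (s * s) * B v v + 2 * s * B u v"
        using B u v by (simp add: psd_on_def algebra_simps)
      finally show ?thesis using quad[of ?x] s by simp
    qed
    show ?thesis using pm[of 1] pm[of "-1"] two by simp
  qed
qed

text \<open>Maximisers exist because the feasible set, restricted to \<open>V \<times> V\<close>, is compact.\<close>

lemma trace_max_exists:
  fixes V :: "'a set" and S :: "'a \<Rightarrow> 'a \<Rightarrow> real set"
  assumes V: "finite V" "V \<noteq> {}"
    and S: "\<And>u v. closed (S u v)" "\<And>u. S u u \<supseteq> {0..}" "\<And>u v. u \<noteq> v \<Longrightarrow> 0 \<in> S u v"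
  defines "F \<equiv> {B. psd_on V B \<and> trace_on V B = 1 \<and> (\<forall>u\<in>V. \<forall>v\<in>V. B u v \<in> S u v)}"
  defines "val \<equiv> \<lambda>B. trace_on V (mat_mult_on V B all_ones)"
  shows "\<exists>B\<in>F. \<forall>C\<in>F. val C \<le> val B"
proof -
  define box where "box = (\<lambda>u v. if u \<in> V \<and> v \<in> V then {-1..1::real} else {0})"
  define P where "P = {B. \<forall>u v. B u v \<in> box u v}"
  have P_eq: "P = PiE UNIV (\<lambda>u. PiE UNIV (box u))"
    by (auto simp: P_def PiE_UNIV_domain)
  have cbox: "compact (box u v)" for u v
    by (simp add: box_def)
  have "compactin (product_topology (\<lambda>_. euclidean) UNIV) (PiE UNIV (box u))" for u
    unfolding compactin_PiE using cbox by simp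
  then have crow: "compact (PiE UNIV (box u))" for u
    by (simp add: euclidean_product_topology flip: compactin_euclidean_iff)
  have "compactin (product_topology (\<lambda>_. euclidean) UNIV) P"
    unfolding P_eq compactin_PiE using crow by simp
  then have cP: "compact P"
    by (simp add: euclidean_product_topology flip: compactin_euclidean_iff)
  have entry: "continuous_on UNIV (\<lambda>B :: 'a \<Rightarrow> 'a \<Rightarrow> real. B u v)" for u v
    by (rule continuous_on_product_then_coordinatewise)
       (rule continuous_on_product_coordinates)
  have "F = (\<Inter>u\<in>V. \<Inter>v\<in>V. {B. B u v = B v u}) \<inter>
      (\<Inter>x. {B. (\<Sum>v\<in>V. \<Sum>w\<in>V. x v * B v w * x w) \<ge> 0}) \<inter>
      {B. (\<Sum>v\<in>V. B v v) = 1} \<inter> (\<Inter>u\<in>V. \<Inter>v\<in>V. (\<lambda>B. B u v) -` S u v)"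
    by (auto simp: F_def psd_on_def trace_on_def)
  also have "closed \<dots>"
    by (intro closed_Int closed_INT ballI closed_Collect_eq closed_Collect_le
        continuous_intros entry closed_vimage S)
  finally have clF: "closed F" .
  let ?K = "P \<inter> F"
  have cK: "compact ?K" by (rule compact_Int_closed[OF cP clF])
  have restr: "\<exists>B'\<in>?K. val B' = val B" if B: "B \<in> F" for B
  proof (intro bexI)
    let ?B' = "\<lambda>u v. if u \<in> V \<and> v \<in> V then B u v else 0"
    show "val ?B' = val B"
      unfolding val_def trace_on_def mat_mult_on_def by (intro sum.cong refl) auto
    have "(\<Sum>v\<in>V. \<Sum>w\<in>V. x v * ?B' v w * x w) = (\<Sum>v\<in>V. \<Sum>w\<in>V. x v * B v w * x w)" for x
      by (intro sum.cong refl) auto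
    then have "?B' \<in> F" using B by (simp add: F_def psd_on_def trace_on_def)
    moreover have "\<bar>B u v\<bar> \<le> 1" if "u \<in> V" "v \<in> V" for u v
      using psd_on_entry_bound[OF V(1) _ _ that] B by (simp add: F_def)
    then have "?B' \<in> P" by (fastforce simp: P_def box_def abs_le_iff)
    ultimately show "?B' \<in> ?K" by blast
  qed
  have "F \<noteq> {}"
  proof -
    let ?I = "\<lambda>u v. if u = v then 1 / real (card V) else (0 :: real)"
    have "(\<Sum>v\<in>V. \<Sum>w\<in>V. x v * ?I v w * x w) = (\<Sum>v\<in>V. x v * x v / real (card V))" for x
    proof (intro sum.cong refl)
      fix v assume "v \<in> V"
      have "(\<Sum>w\<in>V. x v * ?I v w * x w) = (\<Sum>w\<in>V. if v = w then x v * x v / real (card V) else 0)"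
        by (intro sum.cong refl) auto
      then show "(\<Sum>w\<in>V. x v * ?I v w * x w) = x v * x v / real (card V)"
        using V \<open>v \<in> V\<close> by simp
    qed
    then have "psd_on V ?I"
      unfolding psd_on_def by (auto intro!: sum_nonneg)
    moreover have "trace_on V ?I = 1" using V by (simp add: trace_on_def)
    moreover have "?I u v \<in> S u v" for u v
      using S(2)[of u] S(3)[of u v] by (auto simp: subset_iff)
    ultimately have "?I \<in> F" unfolding F_def by blast
    then show ?thesis by blast
  qed
  then have "?K \<noteq> {}" using restr by blast
  moreover have "continuous_on ?K val"
    unfolding val_def trace_on_def mat_mult_on_def
    by (intro continuous_intros continuous_on_subset[OF entry]) auto
  ultimately obtain B where "B \<in> ?K" "\<forall>C\<in>?K. val C \<le> val B"
    using continuous_attains_sup[OF cK] by blast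
  then show ?thesis using restr by (metis IntD2)
qed

lemma SUP_attained:
  fixes f :: "'b \<Rightarrow> real"
  assumes "\<exists>B\<in>F. \<forall>C\<in>F. f C \<le> f B"
  shows "\<exists>B\<in>F. f B = (SUP C\<in>F. f C) \<and> (\<forall>C\<in>F. f C \<le> f B)"
proof -
  obtain B where "B \<in> F" "\<forall>C\<in>F. f C \<le> f B" using assms by blast
  moreover from this have "(SUP C\<in>F. f C) = f B" by (intro cSup_eq_maximum) auto
  ultimately show ?thesis by auto
qed

lemma lovasz_theta_max:
  assumes "simple_graph G"
  shows "\<exists>B\<in>lovasz_feasible G.
    trace_on (pverts G) (mat_mult_on (pverts G) B all_ones) = lovasz_theta G \<and>
    (\<forall>C\<in>lovasz_feasible G. trace_on (pverts G) (mat_mult_on (pverts G) C all_ones)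
      \<le> trace_on (pverts G) (mat_mult_on (pverts G) B all_ones))"
proof -
  have G: "finite (pverts G)" "pverts G \<noteq> {}" "parcs G \<subseteq> pverts G \<times> pverts G" "irrefl (parcs G)"
    using assms by (auto simp: simple_graph_iff)
  have F: "lovasz_feasible G = {B. psd_on (pverts G) B \<and> trace_on (pverts G) B = 1 \<and>
    (\<forall>u\<in>pverts G. \<forall>v\<in>pverts G. B u v \<in> (if (u, v) \<in> parcs G then {0} else UNIV))}"
    using G(3) unfolding lovasz_feasible_def by fastforce
  show ?thesis unfolding lovasz_theta_def F
    by (intro SUP_attained trace_max_exists) (use G in \<open>auto simp: irrefl_def\<close>)
qed

lemma schrijver_theta_max:
  assumes "simple_graph G"
  shows "\<exists>B\<in>schrijver_feasible G.
    trace_on (pverts G) (mat_mult_on (pverts G) B all_ones) = schrijver_theta G \<and>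
    (\<forall>C\<in>schrijver_feasible G. trace_on (pverts G) (mat_mult_on (pverts G) C all_ones)
      \<le> trace_on (pverts G) (mat_mult_on (pverts G) B all_ones))"
proof -
  have G: "finite (pverts G)" "pverts G \<noteq> {}" "parcs G \<subseteq> pverts G \<times> pverts G" "irrefl (parcs G)"
    using assms by (auto simp: simple_graph_iff)
  have F: "schrijver_feasible G = {B. psd_on (pverts G) B \<and> trace_on (pverts G) B = 1 \<and>
    (\<forall>u\<in>pverts G. \<forall>v\<in>pverts G. B u v \<in> (if (u, v) \<in> parcs G then {0} else {0..}))}"
    using G(3) unfolding schrijver_feasible_def by (fastforce split: if_splits)
  show ?thesis unfolding schrijver_theta_def F
    by (intro SUP_attained trace_max_exists) (use G in \<open>auto simp: irrefl_def\<close>)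
qed

lemma szegedy_theta_max:
  assumes "simple_graph G"
  shows "\<exists>B\<in>szegedy_feasible G.
    trace_on (pverts G) (mat_mult_on (pverts G) B all_ones) = szegedy_theta G \<and>
    (\<forall>C\<in>szegedy_feasible G. trace_on (pverts G) (mat_mult_on (pverts G) C all_ones)
      \<le> trace_on (pverts G) (mat_mult_on (pverts G) B all_ones))"
proof -
  have G: "finite (pverts G)" "pverts G \<noteq> {}" "parcs G \<subseteq> pverts G \<times> pverts G" "irrefl (parcs G)"
    using assms by (auto simp: simple_graph_iff)
  have F: "szegedy_feasible G = {B. psd_on (pverts G) B \<and> trace_on (pverts G) B = 1 \<and>
    (\<forall>u\<in>pverts G. \<forall>v\<in>pverts G. B u v \<in> (if (u, v) \<in> parcs G then {..0} else UNIV))}"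
    using G(3) unfolding szegedy_feasible_def by fastforce
  show ?thesis unfolding szegedy_theta_def F
    by (intro SUP_attained trace_max_exists) (use G in \<open>auto simp: irrefl_def\<close>)
qed

end

theory Submission
  imports Defs
begin

text \<open>
  If \<open>B\<close> and \<open>C\<close> are optimal for \<open>G\<close> and \<open>H\<close>, their Kronecker product is positive semidefinite with
  trace 1, and its entries on the edges of \<open>G * H\<close> are at most 0: one factor vanishes there, or one
  is nonpositive and the other nonnegative. Hence it is feasible for the Szegedy number of \<open>G * H\<close>,
  which is at most \<open>\<sigma>(G * H)\<close>: given \<open>k\<close> cliques with indicator vectors \<open>x\<^sub>i\<close> and a feasible \<open>B\<close>
  with quadratic form \<open>q\<close>, convexity gives \<open>q(1) = q(\<Sum> x\<^sub>i) \<le> k \<Sum> q(x\<^sub>i) \<le> k Tr B = k\<close>.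
\<close>

section \<open>Quadratic forms and Gram representations of positive semidefinite matrices\<close>

definition quad_form :: "'a set \<Rightarrow> ('a \<Rightarrow> 'a \<Rightarrow> real) \<Rightarrow> ('a \<Rightarrow> real) \<Rightarrow> real" where
  "quad_form V B x = (\<Sum>v\<in>V. \<Sum>w\<in>V. x v * B v w * x w)"

lemma psd_on_sym: "psd_on V B \<Longrightarrow> v \<in> V \<Longrightarrow> w \<in> V \<Longrightarrow> B v w = B w v"
  by (simp add: psd_on_def)

lemma psd_on_quad_form_nonneg: "psd_on V B \<Longrightarrow> quad_form V B x \<ge> 0"
  by (simp add: psd_on_def quad_form_def)

lemma psd_onI:
  assumes "\<And>v w. v \<in> V \<Longrightarrow> w \<in> V \<Longrightarrow> B v w = B w v" and "\<And>x. quad_form V B x \<ge> 0"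
  shows "psd_on V B"
  using assms by (auto simp: psd_on_def quad_form_def)

lemma trace_mat_mult_all_ones:
  "trace_on V (mat_mult_on V B all_ones) = (\<Sum>v\<in>V. \<Sum>w\<in>V. B v w)"
  by (simp add: trace_on_def mat_mult_on_def all_ones_def)

text \<open>Expands the form along the coordinate vector of \<open>a\<close>; symmetry of
  \<open>B\<close> merges the two cross terms. Read as a quadratic in \<open>t\<close>, it yields
  the sign of the diagonal, the vanishing of a row with zero pivot and the completed square behind
  the Schur complement.\<close>

lemma quad_form_shift:
  assumes "finite V" "a \<in> V" "psd_on V B"
  shows "quad_form V B (\<lambda>v. x v - t * of_bool (v = a))
    = quad_form V B x - 2 * t * (\<Sum>w\<in>V. B a w * x w) + t\<^sup>2 * B a a"
proof -
  define e :: "'a \<Rightarrow> real" where "e v = of_bool (v = a)" for v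
  have pick: "(\<Sum>v\<in>V. e v * f v) = f a" for f
    using assms(1,2) by (simp add: e_def of_bool_def if_distrib[of "\<lambda>c. c * _"] cong: if_cong)
  have "quad_form V B (\<lambda>v. x v - t * e v)
    = (\<Sum>v\<in>V. \<Sum>w\<in>V. x v * B v w * x w - t * (e w * (x v * B v w)) - t * (e v * (B v w * x w))
        + t\<^sup>2 * (e v * (e w * B v w)))"
    unfolding quad_form_def by (intro sum.cong refl) (simp add: algebra_simps power2_eq_square)
  also have "\<dots> = quad_form V B x - t * (\<Sum>v\<in>V. x v * B v a) - t * (\<Sum>w\<in>V. B a w * x w) + t\<^sup>2 * B a a"
    by (simp add: sum.distrib sum_subtractf quad_form_def pick flip: sum_distrib_left)
  also have "(\<Sum>v\<in>V. x v * B v a) = (\<Sum>w\<in>V. B a w * x w)"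
    by (intro sum.cong refl) (simp add: psd_on_sym[OF assms(3) _ assms(2)])
  finally show ?thesis by (simp add: e_def)
qed

lemma psd_on_diag_nonneg:
  assumes "finite V" "a \<in> V" "psd_on V B"
  shows "B a a \<ge> 0"
  using quad_form_shift[OF assms, of "\<lambda>_. 0" 1]
    psd_on_quad_form_nonneg[OF assms(3), of "\<lambda>v. 0 - 1 * of_bool (v = a)"]
  by (simp add: quad_form_def)

text \<open>With a zero pivot the shifted form is affine in \<open>t\<close>, so it can stay
  nonnegative for all \<open>t\<close> only if its slope vanishes.\<close>

lemma psd_on_row_form_zero:
  assumes "finite V" "a \<in> V" "psd_on V B" and "B a a = 0"
  shows "(\<Sum>w\<in>V. B a w * x w) = 0" (is "?s = 0")
proof (rule ccontr)
  assume "?s \<noteq> 0"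
  \<comment> \<open>This \<open>t\<close> would bring the shifted form down to -1.\<close>
  define t where "t = (quad_form V B x + 1) / (2 * ?s)"
  have "0 \<le> quad_form V B x - 2 * t * ?s"
    using psd_on_quad_form_nonneg[OF assms(3)] quad_form_shift[OF assms(1-3), of x t] assms(4)
    by (metis add.right_neutral mult_zero_right)
  also have "2 * t * ?s = quad_form V B x + 1" using \<open>?s \<noteq> 0\<close> by (simp add: t_def)
  finally show False by simp
qed

lemma psd_on_row_zero:
  assumes "finite V" "a \<in> V" "psd_on V B" "B a a = 0" "w \<in> V"
  shows "B a w = 0"
  using psd_on_row_form_zero[OF assms(1-4), of "\<lambda>v. of_bool (v = w)"] assms(1,5)
  by (simp add: of_bool_def if_distrib[of "\<lambda>c. _ * c"] cong: if_cong)

text \<open>One step of the Cholesky decomposition; if \<open>B a a = 0\<close> the subtracted term is 0 as \<open>x / 0 = 0\<close>.\<close>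

lemma psd_on_schur_complement:
  assumes "finite V" "a \<in> V" "psd_on V B"
  shows "psd_on V (\<lambda>v w. B v w - B a v * B a w / B a a)"
proof (rule psd_onI)
  fix v w assume "v \<in> V" "w \<in> V"
  then show "B v w - B a v * B a w / B a a = B w v - B a w * B a v / B a a"
    using psd_on_sym[OF assms(3)] by simp
next
  fix x
  let ?s = "\<Sum>w\<in>V. B a w * x w"
  have "quad_form V (\<lambda>v w. B v w - B a v * B a w / B a a) x
      = quad_form V B x - (\<Sum>v\<in>V. \<Sum>w\<in>V. (B a v * x v) * (B a w * x w)) / B a a"
    by (simp add: quad_form_def sum_subtractf sum_divide_distrib algebra_simps)
  also have "(\<Sum>v\<in>V. \<Sum>w\<in>V. (B a v * x v) * (B a w * x w)) = ?s\<^sup>2"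
    by (simp add: power2_eq_square sum_product)
  \<comment> \<open>Completing the square: for a positive pivot, \<open>?s / B a a\<close> is the
    shift that minimises the form; for a zero pivot, both corrections are 0.\<close>
  also have "quad_form V B x - ?s\<^sup>2 / B a a
      = quad_form V B (\<lambda>v. x v - ?s / B a a * of_bool (v = a))"
    unfolding quad_form_shift[OF assms] by (simp add: power2_eq_square)
  also have "\<dots> \<ge> 0" by (rule psd_on_quad_form_nonneg[OF assms(3)])
  finally show "quad_form V (\<lambda>v w. B v w - B a v * B a w / B a a) x \<ge> 0" .
qed

text \<open>A vector on \<open>U\<close> extends by zero to \<open>V\<close> without changing the
  form.\<close>

lemma psd_on_subset:
  assumes "finite V" "U \<subseteq> V" "psd_on V B"
  shows "psd_on U B"
proof (rule psd_onI)
  fix x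
  let ?y = "\<lambda>v. if v \<in> U then x v else (0 :: real)"
  have "quad_form V B ?y = (\<Sum>v\<in>U. \<Sum>w\<in>V. ?y v * B v w * ?y w)"
    unfolding quad_form_def using assms by (intro sum.mono_neutral_right) auto
  also have "\<dots> = (\<Sum>v\<in>U. \<Sum>w\<in>U. ?y v * B v w * ?y w)"
    using assms by (intro sum.cong refl sum.mono_neutral_right) auto
  also have "\<dots> = quad_form U B x" by (simp add: quad_form_def)
  finally show "quad_form U B x \<ge> 0" using psd_on_quad_form_nonneg[OF assms(3), of ?y] by simp
qed (meson assms(2,3) psd_on_sym subsetD)

text \<open>Cholesky decomposition by induction: the Schur complement at \<open>a\<close> has a Gram
  representation on the remaining indices, and the subtracted rank-one term supplies one more row of
  the factor. Rows are indexed by \<open>V\<close> itself, so the new row gets the index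
  \<open>a\<close>.\<close>

lemma psd_on_gram:
  assumes "finite V" "psd_on V B"
  shows "\<exists>f. \<forall>v\<in>V. \<forall>w\<in>V. B v w = (\<Sum>i\<in>V. f i v * f i w)"
  using assms
proof (induction V arbitrary: B rule: finite_induct)
  case empty
  then show ?case by simp
next
  case (insert a V)
  let ?V = "insert a V"
  let ?C = "\<lambda>v w. B v w - B a v * B a w / B a a"
  have fin: "finite ?V" and a: "a \<in> ?V" using insert by auto
  have "psd_on V ?C"
    using psd_on_subset[OF fin _ psd_on_schur_complement[OF fin a insert.prems]] by blast
  then obtain f where f: "\<forall>v\<in>V. \<forall>w\<in>V. ?C v w = (\<Sum>i\<in>V. f i v * f i w)"
    using insert.IH by blast
  \<comment> \<open>Row \<open>a\<close> is the scaled pivot row, which is 0 for a zero pivot. The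
    other rows are set to 0 at \<open>a\<close>, where the induction hypothesis does not control
    \<open>f\<close>.\<close>
  define g where "g i v = (if i = a then B a v / sqrt (B a a) else if v = a then 0 else f i v)" for i v
  have pivot: "g a v * g a w = B a v * B a w / B a a" for v w
    using psd_on_diag_nonneg[OF fin a insert.prems] by (simp add: g_def)
  \<comment> \<open>Cancelling the pivot fails if it is 0, but then the whole row of
    \<open>B\<close> is 0.\<close>
  have row: "B a w = B a a * B a w / B a a" if "w \<in> ?V" for w
    using psd_on_row_zero[OF fin a insert.prems _ that] by (cases "B a a = 0") auto
  have "B v w = (\<Sum>i\<in>?V. g i v * g i w)" if vw: "v \<in> ?V" "w \<in> ?V" for v w
  proof -
    have ia: "i \<noteq> a" if "i \<in> V" for i using that insert.hyps by auto
    have split: "(\<Sum>i\<in>?V. g i v * g i w) = B a v * B a w / B a a + (\<Sum>i\<in>V. g i v * g i w)"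
      using insert.hyps by (simp add: pivot)
    show ?thesis
    proof (cases "v = a \<or> w = a")
      case True
      then have "(\<Sum>i\<in>V. g i v * g i w) = 0"
        using ia by (intro sum.neutral) (auto simp: g_def)
      moreover have "B v w = B a v * B a w / B a a"
        using True row[OF vw(1)] row[OF vw(2)] psd_on_sym[OF insert.prems vw]
        by (auto simp: mult.commute)
      ultimately show ?thesis using split by simp
    next
      case False
      then have "(\<Sum>i\<in>V. g i v * g i w) = (\<Sum>i\<in>V. f i v * f i w)"
        using ia by (intro sum.cong refl) (auto simp: g_def)
      also have "\<dots> = ?C v w" using f vw False by auto
      finally show ?thesis using split by simp
    qed
  qed
  then show ?case by blast
qed

section \<open>Kronecker products\<close>

definition kronecker ::
    "('a \<Rightarrow> 'a \<Rightarrow> real) \<Rightarrow> ('b \<Rightarrow> 'b \<Rightarrow> real) \<Rightarrow> 'a \<times> 'b \<Rightarrow> 'a \<times> 'b \<Rightarrow> real" where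
  "kronecker B C = (\<lambda>p q. B (fst p) (fst q) * C (snd p) (snd q))"

text \<open>A Gram representation of \<open>C\<close> alone turns the form of the product into a sum
  of values of the form of \<open>B\<close>, one for each Gram row.\<close>

lemma psd_on_kronecker:
  assumes "finite V" "finite W" "psd_on V B" "psd_on W C"
  shows "psd_on (V \<times> W) (kronecker B C)"
proof (rule psd_onI)
  fix p q assume "p \<in> V \<times> W" "q \<in> V \<times> W"
  then show "kronecker B C p q = kronecker B C q p"
    using psd_on_sym[OF assms(3)] psd_on_sym[OF assms(4)] by (auto simp: kronecker_def)
next
  fix x :: "'a \<times> 'b \<Rightarrow> real"
  obtain f where f: "\<forall>v\<in>W. \<forall>w\<in>W. C v w = (\<Sum>i\<in>W. f i v * f i w)"
    using psd_on_gram[OF assms(2,4)] by blast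
  \<comment> \<open>\<open>y i\<close> contracts the second coordinate of \<open>x\<close> with the
    \<open>i\<close>-th Gram row of \<open>C\<close>.\<close>
  define y where "y i v = (\<Sum>v'\<in>W. f i v' * x (v, v'))" for i v
  have "quad_form (V \<times> W) (kronecker B C) x
      = (\<Sum>v\<in>V. \<Sum>v'\<in>W. \<Sum>w\<in>V. \<Sum>w'\<in>W. x (v, v') * (B v w * C v' w') * x (w, w'))"
    by (simp add: quad_form_def kronecker_def sum.cartesian_product')
  also have "\<dots> = (\<Sum>v\<in>V. \<Sum>v'\<in>W. \<Sum>w\<in>V. \<Sum>w'\<in>W. \<Sum>i\<in>W.
      B v w * ((f i v' * x (v, v')) * (f i w' * x (w, w'))))"
    using f by (intro sum.cong refl) (simp add: sum_distrib_left sum_distrib_right algebra_simps)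
  \<comment> \<open>The interchanges move the sum over \<open>w\<close> and then the one over
    \<open>i\<close> outward, until the sums over \<open>v'\<close> and \<open>w'\<close> factor
    into \<open>y i v\<close> and \<open>y i w\<close>.\<close>
  also have "\<dots> = (\<Sum>v\<in>V. \<Sum>w\<in>V. \<Sum>v'\<in>W. \<Sum>w'\<in>W. \<Sum>i\<in>W.
      B v w * ((f i v' * x (v, v')) * (f i w' * x (w, w'))))"
    by (intro sum.cong refl sum.swap)
  also have "\<dots> = (\<Sum>v\<in>V. \<Sum>w\<in>V. \<Sum>v'\<in>W. \<Sum>i\<in>W. \<Sum>w'\<in>W.
      B v w * ((f i v' * x (v, v')) * (f i w' * x (w, w'))))"
    by (intro sum.cong refl sum.swap)
  also have "\<dots> = (\<Sum>v\<in>V. \<Sum>w\<in>V. \<Sum>i\<in>W. \<Sum>v'\<in>W. \<Sum>w'\<in>W.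
      B v w * ((f i v' * x (v, v')) * (f i w' * x (w, w'))))"
    by (intro sum.cong refl sum.swap)
  also have "\<dots> = (\<Sum>v\<in>V. \<Sum>w\<in>V. \<Sum>i\<in>W. y i v * B v w * y i w)"
    by (intro sum.cong refl) (simp add: y_def sum_product mult_ac flip: sum_distrib_left)
  also have "\<dots> = (\<Sum>v\<in>V. \<Sum>i\<in>W. \<Sum>w\<in>V. y i v * B v w * y i w)"
    by (intro sum.cong refl sum.swap)
  also have "\<dots> = (\<Sum>i\<in>W. quad_form V B (y i))"
    unfolding quad_form_def by (rule sum.swap)
  also have "\<dots> \<ge> 0"
    by (intro sum_nonneg psd_on_quad_form_nonneg assms(3))
  finally show "quad_form (V \<times> W) (kronecker B C) x \<ge> 0" .
qed

lemma trace_kronecker: "trace_on (V \<times> W) (kronecker B C) = trace_on V B * trace_on W C"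
  by (simp add: trace_on_def kronecker_def sum_product sum.cartesian_product')

lemma sum_kronecker:
  "(\<Sum>p\<in>V \<times> W. \<Sum>q\<in>V \<times> W. kronecker B C p q)
    = (\<Sum>v\<in>V. \<Sum>w\<in>V. B v w) * (\<Sum>v\<in>W. \<Sum>w\<in>W. C v w)"
proof -
  have "(\<Sum>p\<in>V \<times> W. \<Sum>q\<in>V \<times> W. kronecker B C p q)
      = (\<Sum>v\<in>V. \<Sum>v'\<in>W. (\<Sum>w\<in>V. B v w) * (\<Sum>w'\<in>W. C v' w'))"
    by (simp add: kronecker_def sum_product sum.cartesian_product')
  then show ?thesis by (simp add: sum_product)
qed

section \<open>Clique coverings bound the Szegedy value\<close>

text \<open>Summing \<open>q(x\<^sub>i - x\<^sub>j) \<ge> 0\<close> over all pairs gives \<open>q(\<Sum> x\<^sub>i) \<le> k \<Sum> q(x\<^sub>i)\<close>.\<close>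

lemma quad_form_sum_le:
  fixes x :: "'i \<Rightarrow> 'a \<Rightarrow> real"
  assumes "psd_on V B"
  shows "quad_form V B (\<lambda>v. \<Sum>i\<in>I. x i v) \<le> real (card I) * (\<Sum>i\<in>I. quad_form V B (x i))"
proof -
  \<comment> \<open>The bilinear form of \<open>B\<close> on the family; its diagonal
    \<open>b i i\<close> is the quadratic form at \<open>x i\<close>.\<close>
  define b where "b i j = (\<Sum>v\<in>V. \<Sum>w\<in>V. x i v * B v w * x j w)" for i j
  have diff: "quad_form V B (\<lambda>v. x i v - x j v) = b i i + b j j - b i j - b j i" for i j
    by (simp add: quad_form_def b_def algebra_simps sum.distrib sum_subtractf)
  have "quad_form V B (\<lambda>v. \<Sum>i\<in>I. x i v) = (\<Sum>v\<in>V. \<Sum>w\<in>V. \<Sum>i\<in>I. \<Sum>j\<in>I. x i v * B v w * x j w)"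
    unfolding quad_form_def
    by (intro sum.cong refl) (simp add: sum_distrib_left sum_distrib_right sum_product mult_ac)
  also have "\<dots> = (\<Sum>v\<in>V. \<Sum>i\<in>I. \<Sum>w\<in>V. \<Sum>j\<in>I. x i v * B v w * x j w)"
    by (intro sum.cong refl sum.swap)
  also have "\<dots> = (\<Sum>v\<in>V. \<Sum>i\<in>I. \<Sum>j\<in>I. \<Sum>w\<in>V. x i v * B v w * x j w)"
    by (intro sum.cong refl sum.swap)
  also have "\<dots> = (\<Sum>i\<in>I. \<Sum>v\<in>V. \<Sum>j\<in>I. \<Sum>w\<in>V. x i v * B v w * x j w)"
    by (rule sum.swap)
  also have "\<dots> = (\<Sum>i\<in>I. \<Sum>j\<in>I. b i j)"
    unfolding b_def by (intro sum.cong refl sum.swap)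
  finally have total: "quad_form V B (\<lambda>v. \<Sum>i\<in>I. x i v) = (\<Sum>i\<in>I. \<Sum>j\<in>I. b i j)" .
  have "0 \<le> (\<Sum>i\<in>I. \<Sum>j\<in>I. b i i + b j j - b i j - b j i)"
    by (intro sum_nonneg) (metis diff psd_on_quad_form_nonneg[OF assms])
  also have "\<dots> = 2 * (real (card I) * (\<Sum>i\<in>I. b i i)) - (\<Sum>i\<in>I. \<Sum>j\<in>I. b i j) - (\<Sum>i\<in>I. \<Sum>j\<in>I. b j i)"
    by (simp add: sum.distrib sum_subtractf flip: sum_distrib_left)
  also have "(\<Sum>i\<in>I. \<Sum>j\<in>I. b j i) = (\<Sum>i\<in>I. \<Sum>j\<in>I. b i j)" by (rule sum.swap)
  finally have "(\<Sum>i\<in>I. \<Sum>j\<in>I. b i j) \<le> real (card I) * (\<Sum>i\<in>I. b i i)" by simp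
  then show ?thesis using total by (simp add: b_def quad_form_def)
qed

text \<open>\<open>LEAST\<close> is meaningful only if some colouring exists. An injective numbering
  of the finite vertex set is one, because arcs join distinct vertices.\<close>

lemma chromatic_number_attained:
  assumes "simple_graph G"
  shows "\<exists>c. proper_coloring G (chromatic_number G) c"
proof -
  have G: "finite (pverts G)" "parcs G \<subseteq> pverts G \<times> pverts G" "irrefl (parcs G)"
    using assms by (auto simp: simple_graph_iff)
  obtain c n where c: "c ` pverts G = {i::nat. i < n}" "inj_on c (pverts G)"
    using finite_imp_inj_to_nat_seg[OF G(1)] by blast
  then have "proper_coloring G n c"
    using G(2,3) by (fastforce simp: proper_coloring_def irrefl_def inj_on_def)
  then have "\<exists>k c. proper_coloring G k c" by blast
  then show ?thesis
    unfolding chromatic_number_def by (rule LeastI_ex[of "\<lambda>k. \<exists>c. proper_coloring G k c"])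
qed

lemma szegedy_value_le_clique_covering_number:
  assumes G: "simple_graph G" and B: "B \<in> szegedy_feasible G"
  shows "(\<Sum>v\<in>pverts G. \<Sum>w\<in>pverts G. B v w) \<le> real (clique_covering_number G)"
proof -
  let ?V = "pverts G"
  define k where "k = clique_covering_number G"
  have fin: "finite ?V" using G by (simp add: simple_graph_iff)
  have psd: "psd_on ?V B" and tr: "(\<Sum>v\<in>?V. B v v) = 1"
    using B by (auto simp: szegedy_feasible_def trace_on_def)
  have edge: "B v w \<le> 0" if "(v, w) \<in> parcs G" for v w
    using B that by (simp add: szegedy_feasible_def)
  obtain c where "proper_coloring (complement_graph G) k c"
    using chromatic_number_attained[OF simple_graph_complement[OF G]]
    unfolding k_def clique_covering_number_def by blast
  then have col: "\<And>v. v \<in> ?V \<Longrightarrow> c v < k"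
    "\<And>v w. (v, w) \<in> parcs (complement_graph G) \<Longrightarrow> c v \<noteq> c w"
    by (auto simp: proper_coloring_def complement_graph_def)
  \<comment> \<open>Colour classes of the complement are cliques of \<open>G\<close>.\<close>
  have same: "v = w \<or> (v, w) \<in> parcs G" if "v \<in> ?V" "w \<in> ?V" "c v = c w" for v w
    using that col(2)[of v w] by (auto simp: complement_graph_def)
  define x :: "nat \<Rightarrow> 'a \<Rightarrow> real" where "x i v = of_bool (c v = i)" for i v
  \<comment> \<open>Each vertex has exactly one colour below \<open>k\<close>. With
    \<open>f = 1\<close> this writes the all-ones vector as the sum of the class indicators; later
    it collapses the sum over colours.\<close>
  have one: "(\<Sum>i<k. x i v * f i) = f (c v)" if "v \<in> ?V" for v and f :: "nat \<Rightarrow> real"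
    using col(1)[OF that] by (simp add: x_def of_bool_def if_distrib[of "\<lambda>c. c * _"] cong: if_cong)
  have "(\<Sum>v\<in>?V. \<Sum>w\<in>?V. B v w) = quad_form ?V B (\<lambda>v. \<Sum>i<k. x i v)"
    unfolding quad_form_def using one[of _ "\<lambda>_. 1"] by (intro sum.cong refl) simp
  also have "\<dots> \<le> real k * (\<Sum>i<k. quad_form ?V B (x i))"
    using quad_form_sum_le[OF psd, of x "{..<k}"] by simp
  also have "(\<Sum>i<k. quad_form ?V B (x i)) = (\<Sum>v\<in>?V. \<Sum>i<k. \<Sum>w\<in>?V. x i v * B v w * x i w)"
    unfolding quad_form_def by (rule sum.swap)
  also have "\<dots> = (\<Sum>v\<in>?V. \<Sum>w\<in>?V. \<Sum>i<k. x i v * B v w * x i w)"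
    by (intro sum.cong refl sum.swap)
  also have "\<dots> = (\<Sum>v\<in>?V. \<Sum>w\<in>?V. B v w * x (c v) w)"
    using one by (intro sum.cong refl) (simp add: mult.assoc)
  also have "\<dots> \<le> (\<Sum>v\<in>?V. \<Sum>w\<in>?V. if w = v then B v w else 0)"
    using same edge by (intro sum_mono) (fastforce simp: x_def)
  also have "\<dots> = 1" using fin tr by simp
  finally show ?thesis by (simp add: k_def mult_left_mono)
qed

section \<open>Lower bounds for the disjunctive product\<close>

text \<open>Isolates the sign condition \<open>edge\<close>, which the three pairs of feasible sets
  below meet for different reasons.\<close>

lemma clique_covering_number_disjunctive_product_ge:
  assumes G: "simple_graph G" and H: "simple_graph H"
    and B: "psd_on (pverts G) B" "trace_on (pverts G) B = 1"
    and C: "psd_on (pverts H) C" "trace_on (pverts H) C = 1"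
    and edge: "\<And>v w v' w'. v \<in> pverts G \<Longrightarrow> w \<in> pverts G \<Longrightarrow> v' \<in> pverts H \<Longrightarrow> w' \<in> pverts H \<Longrightarrow>
      (v, w) \<in> parcs G \<or> (v', w') \<in> parcs H \<Longrightarrow> B v w * C v' w' \<le> 0"
  shows "trace_on (pverts G) (mat_mult_on (pverts G) B all_ones) *
      trace_on (pverts H) (mat_mult_on (pverts H) C all_ones)
    \<le> real (clique_covering_number (disjunctive_product G H))"
proof -
  let ?P = "disjunctive_product G H"
  have verts: "pverts ?P = pverts G \<times> pverts H" by (simp add: disjunctive_product_def)
  have "finite (pverts G)" "finite (pverts H)" using G H by (auto simp: simple_graph_iff)
  then have "psd_on (pverts ?P) (kronecker B C)"
    unfolding verts using B C by (intro psd_on_kronecker)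
  moreover have "kronecker B C p q \<le> 0" if "(p, q) \<in> parcs ?P" for p q
    using that edge by (auto simp: disjunctive_product_def kronecker_def)
  ultimately have "kronecker B C \<in> szegedy_feasible ?P"
    using B C by (auto simp: szegedy_feasible_def verts trace_kronecker)
  from szegedy_value_le_clique_covering_number[OF simple_graph_disjunctive_product[OF G H] this]
  show ?thesis by (simp add: verts sum_kronecker trace_mat_mult_all_ones)
qed

lemma clique_covering_number_ge_lovasz_lovasz:
  assumes G: "simple_graph G" and H: "simple_graph H"
  shows "lovasz_theta G * lovasz_theta H \<le> real (clique_covering_number (disjunctive_product G H))"
proof -
  obtain B C where "B \<in> lovasz_feasible G" "C \<in> lovasz_feasible H"
    and val: "trace_on (pverts G) (mat_mult_on (pverts G) B all_ones) = lovasz_theta G"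
      "trace_on (pverts H) (mat_mult_on (pverts H) C all_ones) = lovasz_theta H"
    using lovasz_theta_max[OF G] lovasz_theta_max[OF H] by blast
  then show ?thesis
    unfolding val[symmetric]
    by (intro clique_covering_number_disjunctive_product_ge G H) (auto simp: lovasz_feasible_def)
qed

text \<open>On an edge of \<open>G\<close> a nonpositive entry of \<open>B\<close> meets a
  nonnegative entry of \<open>C\<close>; on an edge of \<open>H\<close> the entry of
  \<open>C\<close> is 0.\<close>

lemma clique_covering_number_ge_szegedy_schrijver:
  assumes G: "simple_graph G" and H: "simple_graph H"
  shows "szegedy_theta G * schrijver_theta H \<le> real (clique_covering_number (disjunctive_product G H))"
proof -
  obtain B C where "B \<in> szegedy_feasible G" "C \<in> schrijver_feasible H"
    and val: "trace_on (pverts G) (mat_mult_on (pverts G) B all_ones) = szegedy_theta G"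
      "trace_on (pverts H) (mat_mult_on (pverts H) C all_ones) = schrijver_theta H"
    using szegedy_theta_max[OF G] schrijver_theta_max[OF H] by blast
  then show ?thesis
    unfolding val[symmetric]
    by (intro clique_covering_number_disjunctive_product_ge G H)
      (auto simp: szegedy_feasible_def schrijver_feasible_def intro: mult_nonpos_nonneg)
qed

text \<open>Serves the infimum with \<open>szegedy_theta H\<close> in the denominator. It comes from
  the common bound directly rather than through the isomorphism that swaps the factors.\<close>

lemma clique_covering_number_ge_schrijver_szegedy:
  assumes G: "simple_graph G" and H: "simple_graph H"
  shows "schrijver_theta G * szegedy_theta H \<le> real (clique_covering_number (disjunctive_product G H))"
proof -
  obtain B C where "B \<in> schrijver_feasible G" "C \<in> szegedy_feasible H"
    and val: "trace_on (pverts G) (mat_mult_on (pverts G) B all_ones) = schrijver_theta G"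
      "trace_on (pverts H) (mat_mult_on (pverts H) C all_ones) = szegedy_theta H"
    using schrijver_theta_max[OF G] szegedy_theta_max[OF H] by blast
  then show ?thesis
    unfolding val[symmetric]
    by (intro clique_covering_number_disjunctive_product_ge G H)
      (auto simp: szegedy_feasible_def schrijver_feasible_def intro: mult_nonneg_nonpos)
qed

section \<open>Complements, positivity and infima\<close>

text \<open>Since there are no loops, equal coordinates count as nonadjacent, so two distinct pairs
  are nonadjacent exactly when each coordinate is equal or adjacent in the complement. These are the
  three cases of the strong product.\<close>

lemma complement_disjunctive_product:
  assumes "simple_graph G" "simple_graph H"
  shows "complement_graph (disjunctive_product G H)
    = strong_product (complement_graph G) (complement_graph H)"
proof -
  have loops: "(v, v) \<notin> parcs G" "(v', v') \<notin> parcs H" for v v'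
    using assms by (auto simp: simple_graph_iff irrefl_def)
  have "p \<in> parcs (complement_graph (disjunctive_product G H))
      \<longleftrightarrow> p \<in> parcs (strong_product (complement_graph G) (complement_graph H))" for p
  proof -
    obtain v v' w w' where p: "p = ((v, v'), (w, w'))" by (metis surj_pair)
    show ?thesis
      unfolding p complement_graph_def disjunctive_product_def strong_product_def
      using loops by (cases "v = w"; cases "v' = w'") auto
  qed
  then have "parcs (complement_graph (disjunctive_product G H))
      = parcs (strong_product (complement_graph G) (complement_graph H))"
    by blast
  moreover have "pverts (complement_graph (disjunctive_product G H))
      = pverts (strong_product (complement_graph G) (complement_graph H))"
    by (simp add: complement_graph_def disjunctive_product_def strong_product_def)
  ultimately show ?thesis by simp
qed

text \<open>The matrix with a single 1 at a diagonal position \<open>(a, a)\<close> is feasible for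
  all three programs and has value 1. Positivity permits dividing in the infima.\<close>

lemma theta_pos:
  assumes "simple_graph G"
  shows "schrijver_theta G > 0" "lovasz_theta G > 0" "szegedy_theta G > 0"
proof -
  obtain a where a: "a \<in> pverts G" and fin: "finite (pverts G)" and irr: "irrefl (parcs G)"
    using assms by (auto simp: simple_graph_iff)
  define E :: "'a \<Rightarrow> 'a \<Rightarrow> real" where "E v w = (if v = a then if w = a then 1 else 0 else 0)" for v w
  have "quad_form (pverts G) E x
    = (\<Sum>v\<in>pverts G. if v = a then \<Sum>w\<in>pverts G. if w = a then x v * x w else 0 else 0)" for x
    unfolding quad_form_def E_def by (intro sum.cong refl) (auto intro!: sum.cong)
  then have "quad_form (pverts G) E x = x a * x a" for x
    using a fin by simp
  then have "psd_on (pverts G) E" by (intro psd_onI) (auto simp: E_def)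
  moreover have "trace_on (pverts G) E = 1"
    using a fin by (simp add: trace_on_def E_def)
  ultimately have E: "E \<in> schrijver_feasible G" "E \<in> lovasz_feasible G" "E \<in> szegedy_feasible G"
    using irr
    by (auto simp: schrijver_feasible_def lovasz_feasible_def szegedy_feasible_def E_def irrefl_def)
  have "(\<Sum>v\<in>pverts G. \<Sum>w\<in>pverts G. E v w) = (\<Sum>v\<in>pverts G. if v = a then 1 else 0)"
    using a fin by (intro sum.cong refl) (simp add: E_def)
  then have val: "trace_on (pverts G) (mat_mult_on (pverts G) E all_ones) = 1"
    using a fin by (simp add: trace_mat_mult_all_ones)
  show "schrijver_theta G > 0" using schrijver_theta_max[OF assms] E(1) val by fastforce
  show "lovasz_theta G > 0" using lovasz_theta_max[OF assms] E(2) val by fastforce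
  show "szegedy_theta G > 0" using szegedy_theta_max[OF assms] E(3) val by fastforce
qed

lemma INF_simple_graph_ge:
  fixes f g :: "'b pair_pre_digraph \<Rightarrow> real"
  assumes "\<And>H. simple_graph H \<Longrightarrow> g H > 0" "\<And>H. simple_graph H \<Longrightarrow> c * g H \<le> f H"
  shows "(INF H\<in>{H. simple_graph H}. f H / g H) \<ge> c"
proof (rule cINF_greatest)
  \<comment> \<open>An infimum of reals can be bounded this way only over a nonempty set, so a
    one-vertex graph on the type \<open>'b\<close> is exhibited.\<close>
  have "simple_graph \<lparr>pverts = {undefined :: 'b}, parcs = {}\<rparr>"
    by (simp add: simple_graph_iff sym_def irrefl_def)
  then show "{H :: 'b pair_pre_digraph. simple_graph H} \<noteq> {}" by blast
qed (use assms in \<open>simp add: pos_le_divide_eq\<close>)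

theorem theorem11:
  fixes G :: "'a pair_pre_digraph"
  assumes "simple_graph G"
  shows "(\<forall>H :: 'b pair_pre_digraph. simple_graph H \<longrightarrow>
      real (clique_covering_number (disjunctive_product G H)) \<ge> lovasz_theta G * lovasz_theta H \<and>
      real (chromatic_number (strong_product (complement_graph G) (complement_graph H)))
        \<ge> lovasz_theta G * lovasz_theta H \<and>
      real (clique_covering_number (disjunctive_product G H)) \<ge> szegedy_theta G * schrijver_theta H \<and>
      real (chromatic_number (strong_product (complement_graph G) (complement_graph H)))
        \<ge> szegedy_theta G * schrijver_theta H) \<and>
    (INF H\<in>{H :: 'b pair_pre_digraph. simple_graph H}.
      real (clique_covering_number (disjunctive_product G H)) / lovasz_theta H) \<ge> lovasz_theta G \<and>
    (INF H\<in>{H :: 'b pair_pre_digraph. simple_graph H}.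
      real (clique_covering_number (disjunctive_product G H)) / schrijver_theta H) \<ge> szegedy_theta G \<and>
    (INF H\<in>{H :: 'b pair_pre_digraph. simple_graph H}.
      real (clique_covering_number (disjunctive_product G H)) / szegedy_theta H) \<ge> schrijver_theta G \<and>
    (INF H\<in>{H :: 'b pair_pre_digraph. simple_graph H}.
      real (chromatic_number (strong_product (complement_graph G) (complement_graph H)))
        / lovasz_theta H) \<ge> lovasz_theta G \<and>
    (INF H\<in>{H :: 'b pair_pre_digraph. simple_graph H}.
      real (chromatic_number (strong_product (complement_graph G) (complement_graph H)))
        / schrijver_theta H) \<ge> szegedy_theta G \<and>
    (INF H\<in>{H :: 'b pair_pre_digraph. simple_graph H}.
      real (chromatic_number (strong_product (complement_graph G) (complement_graph H)))
        / szegedy_theta H) \<ge> schrijver_theta G"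
proof -
  \<comment> \<open>Turns every strong-product claim into the corresponding disjunctive one.\<close>
  have strong: "chromatic_number (strong_product (complement_graph G) (complement_graph H))
      = clique_covering_number (disjunctive_product G H)" if "simple_graph H"
    for H :: "'b pair_pre_digraph"
    using complement_disjunctive_product[OF assms that] by (simp add: clique_covering_number_def)
  note ge = clique_covering_number_ge_lovasz_lovasz[OF assms]
    clique_covering_number_ge_szegedy_schrijver[OF assms]
    clique_covering_number_ge_schrijver_szegedy[OF assms]
  show ?thesis
    by (intro conjI allI impI INF_simple_graph_ge) (simp_all add: strong ge theta_pos)
qed

end
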